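(* A pseudocompact Hausdorff abelian group $G$ is $ss$-characterized if and only if $G$ is finite.
   Context: All groups are abelian. A topological group $G$ is pseudocompact if every real-valued continuous function on $G$ is bounded (pseudocompact groups are precompact). A group topology on $G$ is precompact if it is Hausdorff and for every neighborhood $U$ of $0$ there is a finite $F\subseteq G$ with $F+U=G$. A sequence $\mathbf{u}=(u_n)$ in an abelian group $G$ is a $TB$-sequence if there is a precompact group topology on $G$ in which $u_n\to0$; then $\tau_{\mathbf{u}}$ denotes the finest precompact group topology on $G$ in which $u_n\to 0$. A precompact group $(G,\tau)$ is $ss$-characterized if there is a $TB$-sequence $\mathbf{u}$ in $G$ with $\tau=\tau_{\mathbf{u}}$. *)

theory Defs
  imports "HOL-Analysis.Analysis"
begin

text \<open>
  The abelian group is the whole of a type \<open>'a::ab_group_add\<close>. Since several topologies on the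
  same group are compared, topologies are values of type \<open>'a topology\<close> rather than coming from
  the class \<^class>\<open>topological_ab_group_add\<close>.
\<close>

definition group_topology :: "'a::ab_group_add topology \<Rightarrow> bool" where
  "group_topology T \<longleftrightarrow>
     topspace T = UNIV \<and>
     continuous_map (prod_topology T T) T (\<lambda>(x, y). x + y) \<and>
     continuous_map T T uminus"

definition pseudocompact :: "'a topology \<Rightarrow> bool" where
  "pseudocompact T \<longleftrightarrow>
     (\<forall>f :: 'a \<Rightarrow> real. continuous_map T euclideanreal f \<longrightarrow> bounded (f ` topspace T))"

text \<open>\<open>F + U\<close> below is the elementwise sum of sets. Neighbourhoods need not be open.\<close>

definition precompact_group_topology :: "'a::ab_group_add topology \<Rightarrow> bool" where
  "precompact_group_topology T \<longleftrightarrow>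
     group_topology T \<and> Hausdorff_space T \<and>
     (\<forall>U. (\<exists>V. openin T V \<and> 0 \<in> V \<and> V \<subseteq> U) \<longrightarrow> (\<exists>F. finite F \<and> F + U = UNIV))"

definition TB_sequence :: "(nat \<Rightarrow> 'a::ab_group_add) \<Rightarrow> bool" where
  "TB_sequence u \<longleftrightarrow> (\<exists>T. precompact_group_topology T \<and> limitin T u 0 sequentially)"

text \<open>
  \<open>is_tau u T\<close> says that \<open>T\<close> is \<open>\<tau>\<^sub>u\<close>, the finest precompact group topology in which
  \<open>u\<close> converges to \<open>0\<close>; by the lemma \<open>is_tau_unique\<close> there is at most one such \<open>T\<close>.
\<close>

definition is_tau :: "(nat \<Rightarrow> 'a::ab_group_add) \<Rightarrow> 'a topology \<Rightarrow> bool" where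
  "is_tau u T \<longleftrightarrow>
     precompact_group_topology T \<and> limitin T u 0 sequentially \<and>
     (\<forall>S. precompact_group_topology S \<and> limitin S u 0 sequentially \<longrightarrow>
        (\<forall>U. openin S U \<longrightarrow> openin T U))"

lemma is_tau_unique: "is_tau u S \<Longrightarrow> is_tau u T \<Longrightarrow> S = T"
  by (auto simp: is_tau_def topology_eq)

definition ss_characterized :: "'a::ab_group_add topology \<Rightarrow> bool" where
  "ss_characterized T \<longleftrightarrow>
     precompact_group_topology T \<and> (\<exists>u. TB_sequence u \<and> is_tau u T)"

end

theory Submission
  imports Defs
begin

text \<open>
  A finite Hausdorff group is discrete, and a discrete finite group topology is \<open>\<tau>\<^sub>u\<close> for the zero
  sequence. The content is the converse: a pseudocompact \<open>\<tau>\<^sub>u\<close> lives on a finite group. Write \<open>G\<close>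
  for the group and \<open>D\<close> for the subgroup generated by the terms of \<open>u\<close>, which is countable.

  Two principles are played against each other. The first is that \<open>\<tau>\<^sub>u\<close> has many continuous
  characters: joining a precompact group topology with one more character keeps it precompact, so
  by maximality every homomorphism \<open>\<xi>\<close> from \<open>G\<close> to the circle with \<open>\<xi> (u n) \<longlonglongrightarrow> 1\<close> is already
  continuous (\<open>is_tau_character_continuous\<close>). In particular every character that is trivial on
  \<open>D\<close> is continuous, whatever its other values are. The second is that pseudocompactness does not
  tolerate countably infinite homogeneous images: a countable regular Hausdorff pseudocompact space
  is compact, so by Baire it has an isolated point, and if it is homogeneous it is discrete, hence
  finite (\<open>finite_if_countable_pseudocompact_homogeneous\<close>).

  Suppose \<open>G\<close> is uncountable. Then \<open>G\<close> has a quotient \<open>G/N\<close> with \<open>D \<subseteq> N\<close> that is countably infinite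
  (\<open>ex_countably_infinite_quotient\<close>). Characters separate the points of \<open>G/N\<close>, and countably many
  of them suffice since \<open>G/N\<close> is countable. They are trivial on \<open>D\<close>, hence continuous, and together
  they map \<open>G\<close> continuously onto a countably infinite subgroup of a power of the circle, which the
  second principle forbids. So \<open>G\<close> is countable, and the second principle applies to \<open>G\<close> itself.

  The algebra treats an abelian group as a module over the integers. The quotient and the extension
  of characters both come from a subgroup that is maximal among those disjoint from a given set.
\<close>

section \<open>Countable pseudocompact spaces\<close>

lemma pseudocompact_continuous_image:
  fixes X :: "'a topology" and Y :: "'b topology"
  assumes "pseudocompact X" and f: "continuous_map X Y f"
  shows "pseudocompact (subtopology Y (f ` topspace X))"
  unfolding pseudocompact_def
proof (intro allI impI)
  fix h :: "'b \<Rightarrow> real"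
  let ?Z = "subtopology Y (f ` topspace X)"
  assume h: "continuous_map ?Z euclideanreal h"
  have "continuous_map X ?Z f"
    using f by (simp add: continuous_map_in_subtopology image_subset_iff_funcset)
  then have "continuous_map X euclideanreal (h \<circ> f)"
    using h by (rule continuous_map_compose)
  then have "bounded ((h \<circ> f) ` topspace X)"
    using assms(1) by (auto simp: pseudocompact_def)
  moreover have "topspace ?Z = f ` topspace X"
    using continuous_map_image_subset_topspace[OF f] by auto
  ultimately show "bounded (h ` topspace ?Z)"
    by (simp add: image_comp)
qed

text \<open>
  If a countable open cover has no finite subcover, points \<open>x n\<close> chosen outside its first \<open>n\<close>
  members form an infinite set each of whose subsets is closed. Any function on this set is then
  continuous, and Tietze extends an unbounded one to the whole space.
\<close>

lemma pseudocompact_normal_Lindelof_imp_compact: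
  assumes "pseudocompact X" and "normal_space X" and "t1_space X" and "Lindelof_space X"
  shows "compact_space X"
  unfolding compact_space
proof (intro allI impI)
  fix \<U> assume \<U>: "(\<forall>U\<in>\<U>. openin X U) \<and> \<Union>\<U> = topspace X"
  then obtain \<V> where \<V>: "countable \<V>" "\<V> \<subseteq> \<U>" "\<Union>\<V> = topspace X"
    using assms(4) unfolding Lindelof_space_def by meson
  show "\<exists>\<F>. finite \<F> \<and> \<F> \<subseteq> \<U> \<and> \<Union>\<F> = topspace X"
  proof (rule ccontr)
    assume no: "\<not> ?thesis"
    then have "\<V> \<noteq> {}"
      using \<V> by (metis finite.emptyI)
    then have rV: "range (from_nat_into \<V>) = \<V>"
      using \<V>(1) by (simp add: range_from_nat_into)
    \<comment> \<open>The increasing finite partial unions of the cover.\<close>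
    define W where "W n = (\<Union>i<n. from_nat_into \<V> i)" for n
    have "W n \<noteq> topspace X" for n
    proof
      assume "W n = topspace X"
      then have "\<Union>(from_nat_into \<V> ` {..<n}) = topspace X" by (simp add: W_def)
      moreover have "from_nat_into \<V> ` {..<n} \<subseteq> \<U>" using rV \<V>(2) by auto
      ultimately show False using no by (metis finite_imageI finite_lessThan)
    qed
    moreover have in_V: "from_nat_into \<V> i \<in> \<V>" for i
      using rV by blast
    then have "W n \<subseteq> topspace X" for n
      unfolding W_def \<V>(3)[symmetric] by blast
    ultimately have "\<exists>x. x \<in> topspace X \<and> x \<notin> W n" for n
      by blast
    then obtain x where x: "\<And>n. x n \<in> topspace X" "\<And>n. x n \<notin> W n"
      by metis
    define S where "S = range x"
    have S: "S \<subseteq> topspace X" using x(1) by (auto simp: S_def)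
    have W_mono: "W m \<subseteq> W n" if "m \<le> n" for m n
      using that unfolding W_def by (intro UN_mono) auto
    have W_open: "openin X (W n)" for n
      unfolding W_def using \<U> \<V>(2) in_V by (intro openin_Union) blast
    have W_cover: "\<exists>n. y \<in> W n" if "y \<in> topspace X" for y
    proof -
      obtain V where "V \<in> \<V>" "y \<in> V"
        using \<open>y \<in> topspace X\<close> \<V>(3) by blast
      moreover obtain i where "V = from_nat_into \<V> i"
        using rV \<open>V \<in> \<V>\<close> by blast
      ultimately have "y \<in> from_nat_into \<V> i" by simp
      then have "y \<in> W (Suc i)" by (auto simp: W_def)
      then show ?thesis ..
    qed
    have fin: "finite (S \<inter> W n)" for n
    proof (rule finite_subset)
      show "S \<inter> W n \<subseteq> x ` {..<n}"
      proof
        fix y assume "y \<in> S \<inter> W n"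
        then obtain m where "y = x m" "x m \<in> W n" by (auto simp: S_def)
        then show "y \<in> x ` {..<n}" using x(2)[of m] W_mono[of n m] by (cases "m < n") auto
      qed
    qed simp
    \<comment> \<open>Each \<open>W n\<close> meets \<open>S\<close> in a finite set, so \<open>S\<close> is closed and discrete.\<close>
    have closed: "closedin X B" if "B \<subseteq> S" for B
    proof -
      have "finite (B \<inter> W n)" for n
        by (rule finite_subset[OF _ fin[of n]]) (use that in blast)
      then have fclo: "closedin X (B \<inter> W n)" for n
        using assms(3) that S unfolding t1_space_closedin_finite by blast
      have "topspace X - B = (\<Union>n. W n - (B \<inter> W n))"
        using W_cover openin_subset[OF W_open] by fast
      moreover have "openin X (W n - (B \<inter> W n))" for n
        using W_open fclo by (rule openin_diff)
      ultimately have "openin X (topspace X - B)"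
        by (auto intro: openin_clauses(3))
      then show ?thesis
        using that S by (simp add: closedin_def)
    qed
    have "infinite S"
    proof
      assume "finite S"
      moreover have "\<forall>y\<in>S. \<exists>n. y \<in> W n"
        using W_cover S by blast
      then obtain \<nu> where \<nu>: "\<And>y. y \<in> S \<Longrightarrow> y \<in> W (\<nu> y)"
        by metis
      ultimately have "\<nu> y \<le> Max (\<nu> ` S)" if "y \<in> S" for y
        using that by simp
      then have "S \<subseteq> W (Max (\<nu> ` S))"
        using W_mono \<nu> by fast
      then show False using x(2) by (auto simp: S_def)
    qed
    moreover have "countable S" by (simp add: S_def)
    ultimately obtain e :: "'a \<Rightarrow> nat" where e: "bij_betw e S UNIV"
      using to_nat_on_infinite by blast
    have "continuous_map (subtopology X S) euclideanreal (real \<circ> e)"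
    proof -
      have "closedin (subtopology X S) {y \<in> topspace (subtopology X S). (real \<circ> e) y \<in> C}" for C
        by (intro closedin_subset_topspace closed) auto
      then show ?thesis
        unfolding continuous_map_closedin by simp
    qed
    then obtain g where g: "continuous_map X euclideanreal g" "\<And>x. x \<in> S \<Longrightarrow> g x = (real \<circ> e) x"
      using Tietze_extension_realinterval[OF assms(2) closed[OF order_refl], of UNIV "real \<circ> e"]
      by (metis UNIV_not_empty is_interval_univ subset_UNIV)
    have "bounded (g ` topspace X)"
      using assms(1) g(1) by (simp add: pseudocompact_def)
    moreover have "real ` UNIV \<subseteq> g ` topspace X"
    proof -
      have "g ` S = real ` e ` S" using g(2) by (simp add: image_image)
      also have "e ` S = UNIV" using e by (simp add: bij_betw_def)
      finally show ?thesis using S by blast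
    qed
    ultimately have "bounded (range real)" by (rule bounded_subset)
    then obtain b where "\<forall>y\<in>range real. norm y \<le> b"
      unfolding bounded_iff by blast
    then have "real n \<le> b" for n by simp
    then show False
      using reals_Archimedean2[of b] by (meson not_less)
  qed
qed

definition homogeneous_space :: "'a topology \<Rightarrow> bool" where
  "homogeneous_space X \<longleftrightarrow>
     (\<forall>a\<in>topspace X. \<forall>b\<in>topspace X. \<exists>f. homeomorphic_map X X f \<and> f a = b)"

text \<open>
  Countability enters twice: it makes the space Lindelof, hence normal and then compact, and it
  writes the compact space as a countable union of points, one of which must have nonempty
  interior by the Baire category theorem. Homogeneity spreads this isolated point. Without it the
  conclusion fails, as a convergent sequence with its limit shows.
\<close>

lemma finite_if_countable_pseudocompact_homogeneous:
  assumes "countable (topspace X)" and reg: "regular_space X" and haus: "Hausdorff_space X"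
    and "pseudocompact X" and "homogeneous_space X"
  shows "finite (topspace X)"
proof (cases "topspace X = {}")
  case False
  have lind: "Lindelof_space X"
    using assms(1) by (rule countable_imp_Lindelof_space)
  have t1: "t1_space X"
    using haus by (rule Hausdorff_imp_t1_space)
  have "normal_space X"
    using reg lind by (rule regular_Lindelof_imp_normal_space)
  then have compact: "compact_space X"
    using assms(4) t1 lind by (intro pseudocompact_normal_Lindelof_imp_compact)
  have "\<exists>a\<in>topspace X. openin X {a}"
  proof (rule ccontr)
    assume no: "\<not> ?thesis"
    have "X interior_of \<Union>((\<lambda>a. {a}) ` topspace X) = {}"
    proof (rule Baire_category_alt)
      show "completely_metrizable_space X \<or> locally_compact_space X \<and> regular_space X"
        using compact reg by (simp add: compact_imp_locally_compact_space)
      fix S assume "S \<in> (\<lambda>a. {a}) ` topspace X"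
      then obtain a where a: "a \<in> topspace X" "S = {a}" by auto
      have "X interior_of {a} \<noteq> {a}"
        using no a(1) by (metis openin_interior_of)
      moreover have "X interior_of {a} \<subseteq> {a}" by (rule interior_of_subset)
      ultimately show "closedin X S \<and> X interior_of S = {}"
        using t1 a by (auto simp: t1_space_closedin_singleton)
    qed (use assms(1) in simp)
    then show False using False by simp
  qed
  then obtain a where a: "a \<in> topspace X" "openin X {a}" by auto
  have "openin X {b}" if b: "b \<in> topspace X" for b
  proof -
    obtain f where f: "homeomorphic_map X X f" "f a = b"
      using bspec[OF bspec[OF assms(5)[unfolded homogeneous_space_def] a(1)] b] by blast
    then have "openin X (f ` {a})"
      using a by (subst homeomorphic_map_openness) auto
    then show ?thesis using f(2) by simp
  qed
  then have "X = discrete_topology (topspace X)"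
    by (metis discrete_topology_unique)
  then show ?thesis
    using compact compact_space_discrete_topology by metis
qed simp

section \<open>Group topologies\<close>

lemma group_topologyD:
  assumes "group_topology T"
  shows group_topology_topspace: "topspace T = UNIV"
    and group_topology_add: "continuous_map (prod_topology T T) T (\<lambda>(x, y). x + y)"
    and group_topology_minus: "continuous_map T T uminus"
  using assms by (auto simp: group_topology_def)

lemma group_topology_continuous_add:
  assumes "group_topology T" "continuous_map X T f" "continuous_map X T g"
  shows "continuous_map X T (\<lambda>x. f x + g x)"
proof -
  have "continuous_map X (prod_topology T T) (\<lambda>x. (f x, g x))"
    using assms(2,3) by (simp add: continuous_map_pairedI)
  from continuous_map_compose[OF this group_topology_add[OF assms(1)]] show ?thesis
    by (simp add: o_def)
qed

lemma group_topology_continuous_diff: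
  assumes "group_topology T" "continuous_map X T f" "continuous_map X T g"
  shows "continuous_map X T (\<lambda>x. f x - g x)"
proof -
  have "continuous_map X T (\<lambda>x. - g x)"
    using continuous_map_compose[OF assms(3) group_topology_minus[OF assms(1)]] by (simp add: o_def)
  from group_topology_continuous_add[OF assms(1,2) this] show ?thesis
    by simp
qed

lemma group_topology_homeomorphic_translation:
  assumes "group_topology T"
  shows "homeomorphic_map T T (\<lambda>x. a + x)"
proof -
  have cont: "continuous_map T T (\<lambda>x. c + x)" for c
    using group_topology_topspace[OF assms]
    by (intro group_topology_continuous_add[OF assms]) auto
  have "homeomorphic_maps T T (\<lambda>x. a + x) (\<lambda>x. - a + x)"
    unfolding homeomorphic_maps_def using cont by auto
  then show ?thesis
    by (auto simp: homeomorphic_map_maps)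
qed

lemma group_topology_openin_translation:
  assumes "group_topology T" "openin T V"
  shows "openin T ((\<lambda>x. a + x) ` V)"
  using homeomorphic_map_openness_eq[OF group_topology_homeomorphic_translation[OF assms(1)]] assms(2)
  by blast

lemma group_topology_homogeneous:
  assumes "group_topology T"
  shows "homogeneous_space T"
  unfolding homogeneous_space_def
proof (intro ballI)
  fix a b
  show "\<exists>f. homeomorphic_map T T f \<and> f a = b"
    using group_topology_homeomorphic_translation[OF assms, of "b - a"] by force
qed

text \<open>
  Continuity of \<open>(x, y) \<mapsto> a + (x - y)\<close> at the origin. It serves as the halving of neighbourhoods
  that regularity and precompactness arguments need.
\<close>

lemma group_topology_diff_nbhd:
  assumes "group_topology T" "openin T U" "a \<in> U"
  obtains V where "openin T V" "0 \<in> V" "\<And>x y. x \<in> V \<Longrightarrow> y \<in> V \<Longrightarrow> a + (x - y) \<in> U"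
proof -
  have ts: "topspace T = UNIV" using assms(1) by (rule group_topology_topspace)
  have "continuous_map (prod_topology T T) T (\<lambda>p. a + (fst p - snd p))"
    by (intro group_topology_continuous_add group_topology_continuous_diff assms(1)
        continuous_map_fst continuous_map_snd) (simp add: ts)
  then have "openin (prod_topology T T) {p. a + (fst p - snd p) \<in> U}"
    using openin_continuous_map_preimage[OF _ assms(2)] ts by fastforce
  moreover have "(0, 0) \<in> {p. a + (fst p - snd p) \<in> U}" using assms(3) by simp
  ultimately obtain V W where VW: "openin T V" "openin T W" "0 \<in> V" "0 \<in> W"
      "V \<times> W \<subseteq> {p. a + (fst p - snd p) \<in> U}"
    unfolding openin_prod_topology_alt by meson
  show ?thesis
  proof
    show "openin T (V \<inter> W)" "0 \<in> V \<inter> W" using VW by auto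
    show "a + (x - y) \<in> U" if "x \<in> V \<inter> W" "y \<in> V \<inter> W" for x y
      using VW(5) that by auto
  qed
qed

text \<open>
  If \<open>a + (V - V)\<close> misses the closed set \<open>C\<close>, then \<open>a + V\<close> and \<open>C + V\<close> are disjoint.
\<close>

lemma group_topology_regular:
  assumes "group_topology T"
  shows "regular_space T"
  unfolding regular_space_def
proof (intro allI impI, elim conjE)
  have ts: "topspace T = UNIV" using assms by (rule group_topology_topspace)
  fix C a assume C: "closedin T C" and "a \<in> topspace T - C"
  then have "openin T (- C)" "a \<in> - C" by (auto simp: closedin_def ts Compl_eq_Diff_UNIV)
  then obtain V where V: "openin T V" "0 \<in> V"
      "\<And>x y. x \<in> V \<Longrightarrow> y \<in> V \<Longrightarrow> a + (x - y) \<in> - C"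
    using group_topology_diff_nbhd[OF assms] by metis
  let ?A = "(\<lambda>x. a + x) ` V" and ?B = "\<Union>c\<in>C. (\<lambda>x. c + x) ` V"
  have "openin T ?A" "openin T ?B"
    using group_topology_openin_translation[OF assms V(1)] by auto
  moreover have "a \<in> ?A" "C \<subseteq> ?B" using V(2) by force+
  moreover have "disjnt ?A ?B"
  proof -
    have False if "x \<in> V" "y \<in> V" "c \<in> C" "a + x = c + y" for x y c
    proof -
      have "a + (x - y) = c" using that(4) by (metis add_diff_cancel_right' add_diff_eq)
      then show False using V(3)[OF that(1,2)] that(3) by simp
    qed
    then show ?thesis by (fastforce simp: disjnt_def)
  qed
  ultimately show "\<exists>U V. openin T U \<and> openin T V \<and> a \<in> U \<and> C \<subseteq> V \<and> disjnt U V"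
    by blast
qed

section \<open>Adding a character to a topology\<close>

definition circle_character :: "('a::ab_group_add \<Rightarrow> complex) \<Rightarrow> bool" where
  "circle_character \<xi> \<longleftrightarrow> (\<forall>x. cmod (\<xi> x) = 1) \<and> (\<forall>x y. \<xi> (x + y) = \<xi> x * \<xi> y)"

lemma circle_character:
  assumes "circle_character \<xi>"
  shows circle_character_norm: "cmod (\<xi> x) = 1"
    and circle_character_nonzero: "\<xi> x \<noteq> 0"
    and circle_character_add: "\<xi> (x + y) = \<xi> x * \<xi> y"
    and circle_character_0: "\<xi> 0 = 1"
    and circle_character_minus: "\<xi> (- x) = inverse (\<xi> x)"
    and circle_character_diff: "\<xi> (x - y) = \<xi> x / \<xi> y"
proof -
  show norm: "cmod (\<xi> x) = 1" and add: "\<xi> (x + y) = \<xi> x * \<xi> y" for x y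
    using assms by (auto simp: circle_character_def)
  show nz: "\<xi> x \<noteq> 0" for x using norm[of x] by auto
  show zero: "\<xi> 0 = 1" using add[of 0 0] nz[of 0] by simp
  show minus: "\<xi> (- x) = inverse (\<xi> x)" for x
    using add[of "- x" x] by (simp add: zero inverse_unique[symmetric] mult.commute)
  show "\<xi> (x - y) = \<xi> x / \<xi> y"
    using add[of x "- y"] by (simp add: minus divide_inverse)
qed

text \<open>
  The coarsest topology that is finer than \<open>T\<close> and makes \<open>\<xi>\<close> continuous, realised by embedding the
  group into the product with the complex plane as the graph of \<open>\<xi>\<close>.
\<close>

definition join_character :: "'a topology \<Rightarrow> ('a \<Rightarrow> complex) \<Rightarrow> 'a topology" where
  "join_character T \<xi> = pullback_topology UNIV (\<lambda>x. (x, \<xi> x)) (prod_topology T euclidean)"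

lemma openin_join_character:
  "openin (join_character T \<xi>) U \<longleftrightarrow>
     (\<exists>P. openin (prod_topology T euclidean) P \<and> U = {x. (x, \<xi> x) \<in> P})"
  by (auto simp: join_character_def openin_pullback_topology vimage_def)

lemma topspace_join_character [simp]: "topspace (join_character T \<xi>) = topspace T"
  by (auto simp: join_character_def topspace_pullback_topology)

lemma openin_join_character_basic:
  assumes "openin T V" "open W"
  shows "openin (join_character T \<xi>) {x\<in>V. \<xi> x \<in> W}"
  unfolding openin_join_character
  by (rule exI[of _ "V \<times> W"]) (use assms in \<open>auto simp: openin_prod_Times_iff\<close>)

lemma continuous_map_join_characterI:
  assumes "continuous_map X T f" "continuous_map X euclidean (\<lambda>x. \<xi> (f x))"
  shows "continuous_map X (join_character T \<xi>) f"
  unfolding join_character_def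
  by (rule continuous_map_pullback') (use assms in \<open>auto simp: o_def continuous_map_pairedI\<close>)

lemma continuous_map_join_character_id:
  "continuous_map (join_character T \<xi>) T (\<lambda>x. x)"
  "continuous_map (join_character T \<xi>) euclidean \<xi>"
proof -
  show "continuous_map (join_character T \<xi>) T (\<lambda>x. x)"
    using continuous_map_pullback[OF continuous_map_fst, of UNIV "\<lambda>x. (x, \<xi> x)" T euclidean]
    by (simp add: join_character_def o_def)
  show "continuous_map (join_character T \<xi>) euclidean \<xi>"
    using continuous_map_pullback[OF continuous_map_snd, of UNIV "\<lambda>x. (x, \<xi> x)" T euclidean]
    by (simp add: join_character_def o_def)
qed

lemma group_topology_join_character:
  assumes T: "group_topology T" and \<xi>: "circle_character \<xi>"
  shows "group_topology (join_character T \<xi>)"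
  unfolding group_topology_def
proof (intro conjI)
  let ?J = "join_character T \<xi>"
  show "topspace ?J = UNIV" using T by (simp add: group_topology_topspace)
  have "continuous_map (prod_topology ?J ?J) ?J (\<lambda>p. fst p + snd p)"
  proof (rule continuous_map_join_characterI)
    show "continuous_map (prod_topology ?J ?J) T (\<lambda>p. fst p + snd p)"
      by (intro group_topology_continuous_add T)
        (use continuous_map_compose[OF continuous_map_fst continuous_map_join_character_id(1)]
          continuous_map_compose[OF continuous_map_snd continuous_map_join_character_id(1)]
          in \<open>simp_all add: o_def\<close>)
    have "continuous_map (prod_topology ?J ?J) euclidean (\<lambda>p. (\<xi> (fst p), \<xi> (snd p)))"
      unfolding prod_topology_euclidean[symmetric]
      by (intro continuous_map_pairedI)
        (use continuous_map_compose[OF continuous_map_fst continuous_map_join_character_id(2)]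
          continuous_map_compose[OF continuous_map_snd continuous_map_join_character_id(2)]
          in \<open>simp_all add: o_def\<close>)
    moreover have "continuous_map euclidean euclidean (\<lambda>z. fst z * snd z :: complex)"
      unfolding continuous_map_iff_continuous2 by (intro continuous_intros)
    ultimately have "continuous_map (prod_topology ?J ?J) euclidean
        ((\<lambda>z. fst z * snd z) \<circ> (\<lambda>p. (\<xi> (fst p), \<xi> (snd p))))"
      by (rule continuous_map_compose)
    then show "continuous_map (prod_topology ?J ?J) euclidean (\<lambda>p. \<xi> (fst p + snd p))"
      by (simp add: circle_character_add[OF \<xi>] o_def)
  qed
  then show "continuous_map (prod_topology ?J ?J) ?J (\<lambda>(x, y). x + y)"
    by (simp add: case_prod_unfold)
  show "continuous_map ?J ?J uminus"
  proof (rule continuous_map_join_characterI)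
    show "continuous_map ?J T uminus"
      using continuous_map_compose[OF continuous_map_join_character_id(1) group_topology_minus[OF T]]
      by (simp add: o_def)
    have "\<xi> (- x) = cnj (\<xi> x)" for x
      using circle_character_norm[OF \<xi>, of x]
      by (simp add: circle_character_minus[OF \<xi>] inverse_complex_def complex_eq_iff cmod_def)
    moreover have "continuous_map ?J euclidean (cnj \<circ> \<xi>)"
      by (rule continuous_map_compose[OF continuous_map_join_character_id(2)])
        (simp add: continuous_on_cnj)
    ultimately show "continuous_map ?J euclidean (\<lambda>x. \<xi> (- x))"
      by (simp add: o_def)
  qed
qed

lemma Hausdorff_join_character:
  assumes "Hausdorff_space T"
  shows "Hausdorff_space (join_character T \<xi>)"
  unfolding Hausdorff_space_def
proof (intro allI impI)
  fix x y assume "x \<in> topspace (join_character T \<xi>) \<and> y \<in> topspace (join_character T \<xi>) \<and> x \<noteq> y"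
  then obtain U V where "openin T U" "openin T V" "x \<in> U" "y \<in> V" "disjnt U V"
    using assms unfolding Hausdorff_space_def topspace_join_character by meson
  then show "\<exists>U V. openin (join_character T \<xi>) U \<and> openin (join_character T \<xi>) V \<and>
      x \<in> U \<and> y \<in> V \<and> disjnt U V"
    using openin_join_character_basic[of T U UNIV \<xi>] openin_join_character_basic[of T V UNIV \<xi>]
    by (intro exI[of _ U] exI[of _ V]) simp
qed

text \<open>
  Cover the group by finitely many translates of a small neighbourhood \<open>C\<close> and the circle by
  finitely many small balls. The resulting finitely many pieces are small in both senses, so one
  point from each nonempty piece gives a finite set whose translates of \<open>U\<close> cover everything.
\<close>

lemma precompact_join_character:
  assumes T: "precompact_group_topology T" and \<xi>: "circle_character \<xi>"
  shows "precompact_group_topology (join_character T \<xi>)"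
  unfolding precompact_group_topology_def
proof (intro conjI allI impI)
  have gT: "group_topology T" and hT: "Hausdorff_space T"
    and tb: "\<And>U. openin T U \<Longrightarrow> 0 \<in> U \<Longrightarrow> \<exists>F. finite F \<and> F + U = UNIV"
    using T by (auto simp: precompact_group_topology_def)
  let ?J = "join_character T \<xi>"
  show "group_topology ?J" using gT \<xi> by (rule group_topology_join_character)
  show "Hausdorff_space ?J" using hT by (rule Hausdorff_join_character)
  fix U assume "\<exists>V. openin ?J V \<and> 0 \<in> V \<and> V \<subseteq> U"
  then obtain V where V: "openin ?J V" "0 \<in> V" "V \<subseteq> U" by blast
  then obtain P where P: "openin (prod_topology T euclidean) P" "V = {x. (x, \<xi> x) \<in> P}"
    by (auto simp: openin_join_character)
  then have "(0, 1) \<in> P" using V(2) by (simp add: circle_character_0[OF \<xi>])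
  then obtain A B where AB: "openin T A" "open B" "0 \<in> A" "1 \<in> B" "A \<times> B \<subseteq> P"
    using P(1) unfolding openin_prod_topology_alt by (metis open_openin)
  obtain C where C: "openin T C" "0 \<in> C" "\<And>x y. x \<in> C \<Longrightarrow> y \<in> C \<Longrightarrow> 0 + (x - y) \<in> A"
    using group_topology_diff_nbhd[OF gT AB(1,3)] by blast
  obtain e where e: "e > 0" "ball 1 e \<subseteq> B"
    using AB(2,4) by (meson open_contains_ball)
  obtain F where F: "finite F" "F + C = UNIV" using tb[OF C(1,2)] by blast
  have "compact (sphere (0::complex) 1)" by simp
  then obtain Z where Z: "finite Z" "sphere (0::complex) 1 \<subseteq> (\<Union>z\<in>Z. ball z (e/2))"
    using e(1) unfolding compact_eq_totally_bounded
    by (meson half_gt_zero)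
  define piece where "piece f z = {x. x - f \<in> C \<and> dist z (\<xi> x) < e/2}" for f z
  \<comment> \<open>Empty pieces receive an arbitrary point, which does no harm.\<close>
  define pt where "pt f z = (SOME x. x \<in> piece f z)" for f z
  have pt: "pt f z \<in> piece f z" if "x \<in> piece f z" for f z x
    unfolding pt_def using that by (rule someI)
  define E where "E = (\<lambda>(f, z). pt f z) ` (F \<times> Z)"
  have "x \<in> E + U" for x
  proof -
    have "x \<in> F + C" using F(2) by simp
    then obtain f where f: "f \<in> F" "x - f \<in> C" by (auto elim!: set_plus_elim)
    have "\<xi> x \<in> sphere 0 1" by (simp add: circle_character_norm[OF \<xi>])
    then obtain z where z: "z \<in> Z" "dist z (\<xi> x) < e/2" using Z(2) by auto
    let ?p = "pt f z"
    have p: "?p - f \<in> C" "dist z (\<xi> ?p) < e/2"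
      using pt[of x f z] f(2) z(2) by (auto simp: piece_def)
    have "(x - f) - (?p - f) \<in> A" using C(3)[OF f(2) p(1)] by simp
    then have "x - ?p \<in> A" by simp
    moreover have "\<xi> (x - ?p) \<in> B"
    proof -
      have "dist 1 (\<xi> (x - ?p)) = cmod (\<xi> ?p - \<xi> x)"
      proof -
        have "\<xi> ?p - \<xi> x = \<xi> ?p * (1 - \<xi> (x - ?p))"
          by (simp add: circle_character_diff[OF \<xi>] circle_character_nonzero[OF \<xi>] right_diff_distrib)
        then show ?thesis
          by (simp add: norm_mult circle_character_norm[OF \<xi>] dist_norm)
      qed
      also have "\<dots> < e" using dist_triangle_half_r[OF p(2) z(2)] by (simp add: dist_norm)
      finally show ?thesis using e(2) by auto
    qed
    ultimately have "x - ?p \<in> U" using AB(5) P(2) V(3) by auto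
    moreover have "?p \<in> E" using f(1) z(1) by (auto simp: E_def)
    ultimately show ?thesis using set_plus_intro[of ?p E "x - ?p" U] by simp
  qed
  moreover have "finite E" using F(1) Z(1) by (simp add: E_def)
  ultimately show "\<exists>F. finite F \<and> F + U = UNIV" by blast
qed

text \<open>
  The join of \<open>\<tau>\<^sub>u\<close> with \<open>\<xi>\<close> is a competitor in the definition of \<open>\<tau>\<^sub>u\<close>, so it is no finer than
  \<open>\<tau>\<^sub>u\<close> itself. This is where maximality of \<open>\<tau>\<^sub>u\<close> is used.
\<close>

lemma is_tau_character_continuous:
  assumes tau: "is_tau u T" and \<xi>: "circle_character \<xi>" and lim: "(\<lambda>n. \<xi> (u n)) \<longlonglongrightarrow> 1"
  shows "continuous_map T euclidean \<xi>"
proof -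
  let ?J = "join_character T \<xi>"
  note tau = tau[unfolded is_tau_def]
  note pre = conjunct1[OF tau] and u = conjunct1[OF conjunct2[OF tau]]
    and finest = conjunct2[OF conjunct2[OF tau], rule_format, OF conjI]
  have ts: "topspace T = UNIV"
    using pre by (simp add: precompact_group_topology_def group_topology_topspace)
  have "limitin ?J u 0 sequentially"
    unfolding limitin_def
  proof (intro conjI allI impI)
    fix U assume U: "openin ?J U \<and> 0 \<in> U"
    then obtain P where P: "openin (prod_topology T euclidean) P" "U = {x. (x, \<xi> x) \<in> P}"
      by (auto simp: openin_join_character)
    then have "(0, 1) \<in> P" using U by (simp add: circle_character_0[OF \<xi>])
    then obtain A B where AB: "openin T A" "open B" "0 \<in> A" "1 \<in> B" "A \<times> B \<subseteq> P"
      using P(1) unfolding openin_prod_topology_alt by (metis open_openin)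
    have "\<forall>\<^sub>F n in sequentially. u n \<in> A"
      using u AB by (auto simp: limitin_def)
    moreover have "\<forall>\<^sub>F n in sequentially. \<xi> (u n) \<in> B"
      using lim AB(2,4) by (rule topological_tendstoD)
    ultimately show "\<forall>\<^sub>F n in sequentially. u n \<in> U"
      by eventually_elim (use AB(5) P(2) in auto)
  qed (simp add: ts)
  note finer = finest[OF precompact_join_character[OF pre \<xi>] this]
  have "openin T {x \<in> topspace T. \<xi> x \<in> W}" if "open W" for W
    using finer openin_join_character_basic[of T "topspace T" W \<xi>] that by simp
  then show ?thesis
    by (simp add: continuous_map_def)
qed

section \<open>Abelian groups as modules over the integers\<close>

text \<open>
  Zorn's lemma, in the form used both to construct a quotient and to extend a character.
\<close>

lemma (in module) ex_maximal_subspace_disjoint: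
  assumes "subspace S" "S \<inter> B = {}"
  obtains M where "subspace M" "S \<subseteq> M" "M \<inter> B = {}"
    "\<And>x. x \<notin> M \<Longrightarrow> span (insert x M) \<inter> B \<noteq> {}"
proof -
  define \<A> where "\<A> = {M. subspace M \<and> S \<subseteq> M \<and> M \<inter> B = {}}"
  have "\<exists>M\<in>\<A>. \<forall>X\<in>\<A>. M \<subseteq> X \<longrightarrow> X = M"
  proof (rule subset_Zorn_nonempty)
    show "\<A> \<noteq> {}" using assms by (auto simp: \<A>_def)
    fix \<C> assume ne: "\<C> \<noteq> {}" and chain: "subset.chain \<A> \<C>"
    then have mem: "subspace M" "S \<subseteq> M" "M \<inter> B = {}" if "M \<in> \<C>" for M
      using that by (auto simp: \<A>_def subset_chain_def)
    have dir: "\<exists>M\<in>\<C>. x \<in> M \<and> y \<in> M" if xy: "x \<in> \<Union>\<C>" "y \<in> \<Union>\<C>" for x y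
    proof -
      obtain K L where "K \<in> \<C>" "L \<in> \<C>" "x \<in> K" "y \<in> L" using xy by blast
      moreover then have "K \<subseteq> L \<or> L \<subseteq> K" using chain by (simp add: subset_chain_def)
      ultimately show ?thesis by blast
    qed
    have "subspace (\<Union>\<C>)"
    proof (rule subspaceI)
      show "0 \<in> \<Union>\<C>" using ne mem(1) subspace_0 by blast
      show "x + y \<in> \<Union>\<C>" if "x \<in> \<Union>\<C>" "y \<in> \<Union>\<C>" for x y
        using dir[OF that] mem(1) subspace_add by blast
      show "c *s x \<in> \<Union>\<C>" if "x \<in> \<Union>\<C>" for c x
        using that mem(1) subspace_scale by blast
    qed
    moreover have "S \<subseteq> \<Union>\<C>" "\<Union>\<C> \<inter> B = {}" using ne mem(2,3) by blast+
    ultimately show "\<Union>\<C> \<in> \<A>" by (simp add: \<A>_def)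
  qed
  then obtain M where "M \<in> \<A>" and max: "\<And>X. X \<in> \<A> \<Longrightarrow> M \<subseteq> X \<Longrightarrow> X = M" by blast
  then have M: "subspace M" "S \<subseteq> M" "M \<inter> B = {}" by (auto simp: \<A>_def)
  have "span (insert x M) \<inter> B \<noteq> {}" if "x \<notin> M" for x
  proof
    assume disj: "span (insert x M) \<inter> B = {}"
    have sub: "insert x M \<subseteq> span (insert x M)" by (rule span_superset)
    then have "span (insert x M) \<in> \<A>"
      using disj M(2) unfolding \<A>_def by (auto intro: span_base)
    then have "span (insert x M) = M" using sub by (intro max) auto
    then show False using sub that by blast
  qed
  then show ?thesis using that M by blast
qed

text \<open>
  At least one of the two sums is empty, since \<open>nat\<close> sends negative integers to zero.
\<close>

definition zmul :: "int \<Rightarrow> 'a::ab_group_add \<Rightarrow> 'a" where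
  "zmul k x = (\<Sum>i<nat k. x) - (\<Sum>i<nat (- k). x)"

lemma sum_const_lessThan_add:
  fixes m n :: nat
  shows "(\<Sum>i<m + n. x) = (\<Sum>i<m. x) + (\<Sum>i<n. (x::'a::ab_group_add))"
  by (induction n) (simp_all add: add.assoc)

lemma zmul_int_diff: "zmul (int m - int n) x = (\<Sum>i<m. x) - (\<Sum>i<n. x)"
proof (cases "n \<le> m")
  case True
  then obtain d where "m = d + n" by (metis le_add_diff_inverse2)
  then show ?thesis by (simp add: zmul_def sum_const_lessThan_add)
next
  case False
  then obtain d where "n = d + m" by (metis le_add_diff_inverse2 nat_le_linear)
  then show ?thesis by (simp add: zmul_def sum_const_lessThan_add)
qed

lemma zmul_add_left: "zmul (a + b) x = zmul a x + zmul b x"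
proof -
  obtain m n where a: "a = int m - int n" by (rule int_diff_cases)
  obtain k l where b: "b = int k - int l" by (rule int_diff_cases)
  have "a + b = int (m + k) - int (n + l)" by (simp add: a b)
  then have "zmul (a + b) x = (\<Sum>i<m + k. x) - (\<Sum>i<n + l. x)"
    by (simp only: zmul_int_diff)
  then show ?thesis
    unfolding a b zmul_int_diff by (simp add: sum_const_lessThan_add algebra_simps)
qed

lemma zmul_zmul: "zmul a (zmul b x) = zmul (a * b) x"
proof -
  have zero: "zmul 0 x = 0" by (simp add: zmul_def)
  have nat: "(\<Sum>i<m. zmul b x) = zmul (int m * b) x" for m
    by (induction m) (simp_all add: zero zmul_add_left ring_distribs add.commute)
  obtain m n where a: "a = int m - int n" by (rule int_diff_cases)
  have "zmul (int m * b) x = zmul ((int m * b - int n * b) + int n * b) x"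
    by simp
  also have "\<dots> = zmul (a * b) x + zmul (int n * b) x"
    unfolding zmul_add_left by (simp add: a left_diff_distrib)
  finally show ?thesis
    unfolding a zmul_int_diff nat by simp
qed

interpretation zmod: module zmul
proof
  show "zmul a (x + y) = zmul a x + zmul a y" for a and x y :: 'a
    by (simp add: zmul_def sum.distrib)
  show "zmul 1 x = x" for x :: 'a
    by (simp add: zmul_def)
qed (rule zmul_add_left zmul_zmul)+

text \<open>
  Applied to the two projections, this computes integer multiples in a product group.
\<close>

lemma additive_zmul:
  assumes "\<And>x y. f (x + y) = f x + f y"
  shows "f (zmul k x) = zmul k (f x)"
proof -
  interpret additive f by unfold_locales (rule assms)
  show ?thesis by (simp add: zmul_def diff sum)
qed

lemma zmul_real: "zmul k (r::real) = of_int k * r"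
proof -
  obtain m n where "k = int m - int n" by (rule int_diff_cases)
  then show ?thesis by (simp add: zmul_int_diff left_diff_distrib)
qed

lemma zmul_Pair: "zmul k (x, y) = (zmul k x, zmul k y)"
  using additive_zmul[of fst k "(x, y)"] additive_zmul[of snd k "(x, y)"]
  by (simp add: prod_eq_iff)

lemma countable_zmod_span:
  assumes "countable S"
  shows "countable (zmod.span S)"
proof -
  let ?f = "\<lambda>l. sum_list (map (\<lambda>(k, x). zmul k x) l)"
  have "x \<in> ?f ` lists (UNIV \<times> S)" if "x \<in> zmod.span S" for x
    using that
  proof (induction rule: zmod.span_induct_alt)
    case base
    show ?case by (rule image_eqI[of _ _ "[]"]) auto
  next
    case (step k x y)
    then obtain l where "y = ?f l" "l \<in> lists (UNIV \<times> S)" by blast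
    then show ?case using step(1) by (intro image_eqI[of _ _ "(k, x) # l"]) auto
  qed
  then show ?thesis
    using assms by (meson countable_SIGMA countable_image countable_lists countable_subset subsetI uncountable_def
        countableI_type)
qed

text \<open>
  The integers \<open>k\<close> with \<open>k x \<in> D\<close> form an ideal, and ideals of integers are principal. The value
  \<open>m = 0\<close> stands for infinite order modulo \<open>D\<close>.
\<close>

lemma ex_relative_order:
  assumes D: "zmod.subspace D"
  obtains m :: int where "m \<ge> 0" "\<And>k. zmul k x \<in> D \<longleftrightarrow> m dvd k"
proof (cases "\<exists>n::nat. n > 0 \<and> zmul (int n) x \<in> D")
  case True
  define n where "n = (LEAST n::nat. n > 0 \<and> zmul (int n) x \<in> D)"
  have n: "n > 0" "zmul (int n) x \<in> D"
    using LeastI_ex[OF True] by (auto simp: n_def)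
  have least: "n \<le> k" if "k > 0" "zmul (int k) x \<in> D" for k
    unfolding n_def using that by (intro Least_le) auto
  show ?thesis
  proof
    show "zmul k x \<in> D \<longleftrightarrow> int n dvd k" for k
    proof
      assume "int n dvd k"
      then obtain j where "k = j * int n" by (metis dvdE mult.commute)
      then show "zmul k x \<in> D"
        using zmod.subspace_scale[OF D n(2), of j] by simp
    next
      assume k: "zmul k x \<in> D"
      have "k mod int n = k - (k div int n) * int n" by (simp add: minus_div_mult_eq_mod)
      then have "zmul (k mod int n) x = zmul k x - zmul (k div int n) (zmul (int n) x)"
        by (simp add: zmod.scale_left_diff_distrib)
      then have "zmul (k mod int n) x \<in> D"
        using zmod.subspace_diff[OF D k zmod.subspace_scale[OF D n(2)]] by simp
      moreover have "0 \<le> k mod int n" "k mod int n < int n" using n(1) by simp_all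
      ultimately have "k mod int n = 0"
        using least[of "nat (k mod int n)"] by (cases "k mod int n = 0") auto
      then show "int n dvd k" by auto
    qed
  qed simp
next
  case False
  show ?thesis
  proof
    show "zmul k x \<in> D \<longleftrightarrow> 0 dvd k" for k
    proof
      assume k: "zmul k x \<in> D"
      then have "zmul (- k) x \<in> D" by (simp add: zmod.subspace_neg[OF D])
      then have "zmul (int (nat \<bar>k\<bar>)) x \<in> D" using k by (cases "k < 0") simp_all
      then have "\<not> 0 < nat \<bar>k\<bar>" using spec[OF False[simplified], of "nat \<bar>k\<bar>"] by simp
      then show "0 dvd k" by simp
    qed (use zmod.subspace_0[OF D] in simp)
  qed simp
qed

section \<open>A countably infinite quotient\<close>

text \<open>
  The hypothesis says that, modulo \<open>N\<close>, every nonzero cyclic subgroup meets the image of the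
  countable group \<open>A\<close> in a nonzero element; the claim is that \<open>N\<close> has countable index. An element
  of prime order modulo \<open>N\<close> generates a simple group, so it lies in \<open>A + N\<close>. Hence dividing by a
  prime has countable fibres modulo \<open>N\<close>, and by induction on the number of prime factors so has
  dividing by any nonzero integer. As some nonzero integer takes each element into \<open>A + N\<close>, there are
  only countably many cosets.
\<close>

lemma essential_extension_countable:
  fixes N A :: "'a::ab_group_add set"
  assumes N: "zmod.subspace N" and A: "zmod.subspace A" "countable A"
    and ess: "\<And>x. x \<notin> N \<Longrightarrow> \<exists>k. \<exists>a\<in>A - N. zmul k x - a \<in> N"
  obtains R where "countable R" "\<And>x. \<exists>r\<in>R. x - r \<in> N"
proof -
  define X where "X n = {x. \<exists>a\<in>A. zmul n x - a \<in> N}" for n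
  have torsion: "\<exists>a\<in>A. t - a \<in> N" if p: "prime p" and t: "zmul p t \<in> N" for p :: int and t
  proof (cases "t \<in> N")
    case True
    then show ?thesis using zmod.subspace_0[OF A(1)] by (intro bexI[of _ 0]) simp_all
  next
    case False
    then obtain k a where a: "a \<in> A" "a \<notin> N" "zmul k t - a \<in> N" using ess by blast
    have "\<not> p dvd k"
    proof
      assume "p dvd k"
      then obtain j where "k = j * p" by (metis dvdE mult.commute)
      then have "zmul k t \<in> N" using zmod.subspace_scale[OF N t, of j] by simp
      then have "zmul k t - (zmul k t - a) \<in> N" using a(3) by (rule zmod.subspace_diff[OF N])
      then show False using a(2) by simp
    qed
    then have "gcd p k = 1" using p by (simp add: prime_imp_coprime coprime_iff_gcd_eq_1[symmetric])
    then obtain v w where vw: "v * p + w * k = 1" using bezout_int[of p k] by auto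
    have "t - zmul w a = zmul v (zmul p t) + zmul w (zmul k t - a)"
    proof -
      have "t = zmul (v * p + w * k) t" by (simp add: vw)
      then have "t = zmul v (zmul p t) + zmul w (zmul k t)" by (simp add: zmod.scale_left_distrib)
      then show ?thesis by (simp add: zmod.scale_right_diff_distrib)
    qed
    then have "t - zmul w a \<in> N"
      using zmod.subspace_add[OF N zmod.subspace_scale[OF N t] zmod.subspace_scale[OF N a(3)]]
      by simp
    then show ?thesis using zmod.subspace_scale[OF A(1) a(1)] by blast
  qed
  have reps: "n \<noteq> 0 \<longrightarrow> (\<exists>R. countable R \<and> (\<forall>x\<in>X n. \<exists>r\<in>R. x - r \<in> N))" for n :: int
  proof (induction n rule: prime_divisors_induct)
    case (unit n)
    have "\<exists>r\<in>A. x - r \<in> N" if x: "x \<in> X n" for x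
    proof -
      obtain a where a: "a \<in> A" "zmul n x - a \<in> N" using x unfolding X_def by blast
      have "n * n = 1" using unit by (cases "n < 0") (simp_all add: zdvd1_eq)
      then have "x - zmul n a = zmul n (zmul n x - a)" by (simp add: zmod.scale_right_diff_distrib)
      then show ?thesis
        using zmod.subspace_scale[OF N a(2)] zmod.subspace_scale[OF A(1) a(1)] by metis
    qed
    then show ?case using A(2) by blast
  next
    case (factor p n)
    show ?case
    proof
      assume "p * n \<noteq> 0"
      then obtain R where R: "countable R" "\<And>x. x \<in> X n \<Longrightarrow> \<exists>r\<in>R. x - r \<in> N"
        using factor by auto
      \<comment> \<open>A chosen \<open>p\<close>-th part of \<open>r\<close> modulo \<open>N\<close>, meaningful only if there is one.\<close>
      define root where "root r = (SOME x. zmul p x - r \<in> N)" for r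
      have root: "zmul p (root r) - r \<in> N" if "zmul p x - r \<in> N" for r x
        unfolding root_def using that by (rule someI)
      have "\<exists>r\<in>(\<lambda>(r, a). root r + a) ` (R \<times> A). x - r \<in> N" if "x \<in> X (p * n)" for x
      proof -
        have "zmul p x \<in> X n" using that by (simp add: X_def mult.commute)
        then obtain r where r: "r \<in> R" "zmul p x - r \<in> N" using R(2) by blast
        have "(zmul p x - r) - (zmul p (root r) - r) \<in> N"
          using r(2) root[OF r(2)] by (rule zmod.subspace_diff[OF N])
        then have "zmul p (x - root r) \<in> N" by (simp add: zmod.scale_right_diff_distrib)
        then obtain a where "a \<in> A" "(x - root r) - a \<in> N" using torsion factor(1) by blast
        then show ?thesis using r(1) by (intro bexI[of _ "root r + a"]) (auto simp: diff_diff_eq)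
      qed
      moreover have "countable ((\<lambda>(r, a). root r + a) ` (R \<times> A))" using R(1) A(2) by simp
      ultimately show "\<exists>R. countable R \<and> (\<forall>x\<in>X (p * n). \<exists>r\<in>R. x - r \<in> N)" by blast
    qed
  qed simp
  then obtain R where R: "\<And>n. n \<noteq> 0 \<Longrightarrow> countable (R n)"
      "\<And>n x. n \<noteq> 0 \<Longrightarrow> x \<in> X n \<Longrightarrow> \<exists>r\<in>R n. x - r \<in> N"
    by metis
  show ?thesis
  proof
    show "countable (\<Union>n\<in>-{0}. R n)" using R(1) by auto
    fix x
    obtain n where n: "n \<noteq> 0" "x \<in> X n"
    proof (cases "x \<in> N")
      case True
      then have "x \<in> X 1" using zmod.subspace_0[OF A(1)] by (auto simp: X_def intro!: bexI[of _ 0])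
      then show ?thesis using that[of 1] by simp
    next
      case False
      then obtain k a where a: "a \<in> A" "a \<notin> N" "zmul k x - a \<in> N" using ess by blast
      then have "k \<noteq> 0" using zmod.subspace_neg[OF N, of "- a"] by auto
      then show ?thesis using that[of k] a by (auto simp: X_def)
    qed
    then show "\<exists>r\<in>(\<Union>n\<in>-{0}. R n). x - r \<in> N" using R(2) by blast
  qed
qed

text \<open>
  Take a countable group \<open>A\<close> that contains \<open>D\<close> and an infinite set \<open>S\<close> of elements that are pairwise
  incongruent modulo \<open>D\<close>. For \<open>N\<close> maximal among the subgroups that contain \<open>D\<close> and have
  \<open>N \<inter> A = D\<close>, the elements of \<open>S\<close> stay incongruent modulo \<open>N\<close>, so the index is infinite. By
  maximality the quotient is an essential extension of the image of \<open>A\<close>, so the index is countable.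
\<close>

lemma ex_countably_infinite_quotient:
  fixes D :: "'a::ab_group_add set"
  assumes D: "zmod.subspace D" "countable D" and unc: "uncountable (UNIV :: 'a set)"
  obtains N R S where "zmod.subspace N" "D \<subseteq> N" "countable R" "\<And>x. \<exists>r\<in>R. x - r \<in> N"
    "infinite S" "\<And>x y. x \<in> S \<Longrightarrow> y \<in> S \<Longrightarrow> x - y \<in> N \<Longrightarrow> x = y"
proof -
  define q where "q x = (+) x ` D" for x
  have self: "x \<in> q x" for x
    using zmod.subspace_0[OF D(1)] by (force simp: q_def)
  have q_eq: "q x = q y" if "x - y \<in> D" for x y
  proof -
    have "q x \<subseteq> q y" if "x - y \<in> D" for x y
    proof
      fix z assume "z \<in> q x"
      then obtain d where "d \<in> D" "z = x + d" by (auto simp: q_def)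
      then show "z \<in> q y"
        using zmod.subspace_add[OF D(1) that] unfolding q_def
        by (intro image_eqI[of _ _ "(x - y) + d"]) simp_all
    qed
    moreover have "y - x \<in> D" using zmod.subspace_neg[OF D(1) that] by simp
    ultimately show ?thesis using that by blast
  qed
  \<comment> \<open>Countably many points per coset, so an uncountable group has infinitely many cosets.\<close>
  have "infinite (range q)"
  proof
    assume "finite (range q)"
    moreover have "countable (q x)" for x using D(2) by (simp add: q_def)
    ultimately have "countable (\<Union>(range q))"
      by (intro countable_UN[of _ "\<lambda>X. X", simplified]) (auto intro: countable_finite)
    moreover have "\<Union>(range q) = UNIV" using self by blast
    ultimately show False using unc by simp
  qed
  then obtain Q where Q: "Q \<subseteq> range q" "infinite Q" "countable Q"
    by (meson infinite_countable_subset')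
  define S where "S = inv q ` Q"
  have S: "infinite S" "countable S" "inj_on q S"
  proof -
    have "inj_on (inv q) Q" using Q(1) by (meson inj_on_inv_into)
    then show "infinite S" using Q(2) by (simp add: S_def finite_image_iff)
    show "countable S" using Q(3) by (simp add: S_def)
    have "q (inv q X) = X" if "X \<in> Q" for X using Q(1) that by (meson f_inv_into_f subsetD)
    then show "inj_on q S" by (auto simp: S_def intro!: inj_onI)
  qed
  define A where "A = zmod.span (D \<union> S)"
  have A: "zmod.subspace A" "countable A" "D \<subseteq> A" "S \<subseteq> A"
    using D(2) S(2) zmod.span_superset[of "D \<union> S"] by (auto simp: A_def countable_zmod_span)
  obtain N where N: "zmod.subspace N" "D \<subseteq> N" "N \<inter> (A - D) = {}"
      and max: "\<And>x. x \<notin> N \<Longrightarrow> zmod.span (insert x N) \<inter> (A - D) \<noteq> {}"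
    using zmod.ex_maximal_subspace_disjoint[OF D(1), of "A - D"] by auto
  have "\<exists>k. \<exists>a\<in>A - N. zmul k x - a \<in> N" if x: "x \<notin> N" for x
  proof -
    obtain a where a: "a \<in> A" "a \<notin> D" "a \<in> zmod.span (insert x N)" using max[OF x] by blast
    have span: "zmod.span N = N" using N(1) zmod.span_eq_iff by blast
    obtain k where k: "a - zmul k x \<in> N"
      using a(3) unfolding zmod.span_insert span by blast
    have "a \<in> A - N" using a N(3) by blast
    moreover have "zmul k x - a \<in> N" using zmod.subspace_neg[OF N(1) k] by simp
    ultimately show ?thesis by blast
  qed
  then obtain R where R: "countable R" "\<And>x. \<exists>r\<in>R. x - r \<in> N"
    using essential_extension_countable[OF N(1) A(1,2)] by blast
  show ?thesis
  proof (rule that[OF N(1,2) R S(1)])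
    fix x y assume xy: "x \<in> S" "y \<in> S" "x - y \<in> N"
    then have "x - y \<in> A" using A(1,4) by (meson subsetD zmod.subspace_diff)
    then have "x - y \<in> D" using xy(3) N(3) by blast
    then show "x = y" using q_eq xy(1,2) S(3) by (meson inj_onD)
  qed
qed

section \<open>Extension of characters\<close>

text \<open>
  The circle is \<open>\<real>/\<int>\<close>, so a partial character is a subgroup \<open>\<Gamma>\<close> of \<open>G \<times> \<real>\<close> in which \<open>(0, r)\<close>
  occurs only for integral \<open>r\<close>: a relation that is single-valued modulo \<open>\<int>\<close>. Encoding characters
  as subgroups turns extension into the choice of a maximal subgroup disjoint from \<open>B\<close>. A maximal
  one is defined everywhere because \<open>\<real>\<close> is divisible.
\<close>

lemma ex_circle_character:
  fixes N :: "'a::ab_group_add set"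
  assumes N: "zmod.subspace N" and g: "g \<notin> N"
  obtains \<xi> where "circle_character \<xi>" "\<And>x. x \<in> N \<Longrightarrow> \<xi> x = 1" "\<xi> g \<noteq> 1"
proof -
  define B where "B = {(0::'a, r::real) | r. r \<notin> \<int>}"
  obtain m where m: "m \<ge> 0" "\<And>k. zmul k g \<in> N \<longleftrightarrow> m dvd k"
    using ex_relative_order[OF N, of g] by blast
  \<comment> \<open>The value at \<open>g\<close>: its order in \<open>\<real>/\<int>\<close> must divide \<open>m\<close>, with no condition if \<open>m = 0\<close>, and it must not be integral.\<close>
  define \<rho> :: real where "\<rho> = (if m = 0 then 1 / 2 else 1 / of_int m)"
  have "m \<noteq> 1" using m(2)[of 1] g by auto
  then have "0 < \<rho>" "\<rho> < 1" using m(1) by (auto simp: \<rho>_def)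
  then have \<rho>_notin: "\<rho> \<notin> \<int>" by (auto elim!: Ints_cases)
  have k\<rho>: "of_int k * \<rho> \<in> \<int>" if "m dvd k" for k
    using that by (auto simp: \<rho>_def)
  have sub0: "zmod.subspace (N \<times> {0::real})"
    using N by (intro zmod.subspaceI)
      (auto simp: zmul_Pair zmul_real zero_prod_def zmod.subspace_0 zmod.subspace_add zmod.subspace_scale)
  define \<Gamma>0 where "\<Gamma>0 = zmod.span (insert (g, \<rho>) (N \<times> {0}))"
  have mem\<Gamma>0: "(x, r) \<in> \<Gamma>0 \<longleftrightarrow> (\<exists>k. x - zmul k g \<in> N \<and> r = of_int k * \<rho>)" for x r
  proof -
    have span: "zmod.span (N \<times> {0::real}) = N \<times> {0}" using sub0 zmod.span_eq_iff by blast
    show ?thesis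
      unfolding \<Gamma>0_def zmod.span_insert span by (simp add: zmul_Pair zmul_real)
  qed
  have "\<Gamma>0 \<inter> B = {}"
  proof -
    have "r \<in> \<int>" if r: "(0, r) \<in> \<Gamma>0" for r
    proof -
      obtain k where k: "0 - zmul k g \<in> N" "r = of_int k * \<rho>" using r mem\<Gamma>0 by blast
      then have "zmul k g \<in> N" using zmod.subspace_neg[OF N k(1)] by simp
      then have "m dvd k" using m(2) by simp
      then show ?thesis using k\<rho> k(2) by simp
    qed
    then show ?thesis by (auto simp: B_def)
  qed
  moreover have "zmod.subspace \<Gamma>0" by (simp add: \<Gamma>0_def)
  ultimately obtain \<Gamma> where \<Gamma>: "zmod.subspace \<Gamma>" "\<Gamma>0 \<subseteq> \<Gamma>" "\<Gamma> \<inter> B = {}"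
      and max: "\<And>p. p \<notin> \<Gamma> \<Longrightarrow> zmod.span (insert p \<Gamma>) \<inter> B \<noteq> {}"
    using zmod.ex_maximal_subspace_disjoint by metis
  have int_value: "r \<in> \<int>" if "(0, r) \<in> \<Gamma>" for r
    using that \<Gamma>(3) by (auto simp: B_def)
  have total: "\<exists>r. (x, r) \<in> \<Gamma>" for x
  proof (rule ccontr)
    assume no: "\<nexists>r. (x, r) \<in> \<Gamma>"
    have "zmod.subspace (fst ` \<Gamma>)"
    proof (rule zmod.subspaceI)
      show "0 \<in> fst ` \<Gamma>" using zmod.subspace_0[OF \<Gamma>(1)] by (metis fst_zero imageI)
      show "a + b \<in> fst ` \<Gamma>" if "a \<in> fst ` \<Gamma>" "b \<in> fst ` \<Gamma>" for a b
        using that zmod.subspace_add[OF \<Gamma>(1)] by (metis (no_types, lifting) fst_add image_iff)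
      show "zmul k a \<in> fst ` \<Gamma>" if "a \<in> fst ` \<Gamma>" for k a
      proof -
        obtain p where "p \<in> \<Gamma>" "a = fst p" using \<open>a \<in> fst ` \<Gamma>\<close> by blast
        then show ?thesis
          using zmod.subspace_scale[OF \<Gamma>(1), of p k] additive_zmul[of fst k p]
          by (intro image_eqI[of _ _ "zmul k p"]) simp_all
      qed
    qed
    then obtain n where n: "n \<ge> 0" "\<And>k. zmul k x \<in> fst ` \<Gamma> \<longleftrightarrow> n dvd k"
      using ex_relative_order by blast
    then have "zmul n x \<in> fst ` \<Gamma>" by simp
    then obtain s where s: "(zmul n x, s) \<in> \<Gamma>" by force
    \<comment> \<open>Divisibility: \<open>\<sigma>\<close> solves \<open>n \<sigma> = s\<close>, the only constraint on a value at \<open>x\<close>. If \<open>n = 0\<close>, any value would do.\<close>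
    define \<sigma> where "\<sigma> = (if n = 0 then 0 else s / of_int n)"
    have "(x, \<sigma>) \<notin> \<Gamma>" using no by blast
    then obtain r where r: "(0, r) \<in> zmod.span (insert (x, \<sigma>) \<Gamma>)" "r \<notin> \<int>"
      using max unfolding B_def by blast
    have span: "zmod.span \<Gamma> = \<Gamma>" using \<Gamma>(1) zmod.span_eq_iff by blast
    obtain k where k: "(- zmul k x, r - of_int k * \<sigma>) \<in> \<Gamma>"
      using r(1) unfolding zmod.span_insert span by (auto simp: zmul_Pair zmul_real)
    have "zmul (- k) x \<in> fst ` \<Gamma>" using imageI[OF k, of fst] by simp
    then have "n dvd k" unfolding n(2) by simp
    then obtain j where j: "k = j * n" by (metis dvdE mult.commute)
    have "zmul j (zmul n x, s) \<in> \<Gamma>" using s by (rule zmod.subspace_scale[OF \<Gamma>(1)])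
    then have js: "(zmul k x, of_int j * s) \<in> \<Gamma>" by (simp add: zmul_Pair zmul_real j)
    have "r \<in> \<int>"
    proof (cases "n = 0")
      case True
      then show ?thesis using k int_value by (simp add: j \<sigma>_def)
    next
      case False
      have "(- zmul k x, r - of_int k * \<sigma>) + (zmul k x, of_int j * s) = (0, r)"
        using False by (simp add: j \<sigma>_def)
      then show ?thesis
        using zmod.subspace_add[OF \<Gamma>(1) k js] int_value by simp
    qed
    then show False using r(2) by simp
  qed
  define \<xi> where "\<xi> x = cis (2 * pi * (SOME r. (x, r) \<in> \<Gamma>))" for x
  have \<xi>: "\<xi> x = cis (2 * pi * r)" if "(x, r) \<in> \<Gamma>" for x r
  proof -
    define r' where "r' = (SOME r. (x, r) \<in> \<Gamma>)"
    have "(x, r') \<in> \<Gamma>" unfolding r'_def using that by (rule someI)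
    then have "r' - r \<in> \<int>"
      using zmod.subspace_diff[OF \<Gamma>(1) _ that] int_value by fastforce
    then have "cis (2 * pi * (r' - r)) = 1" by (rule cis_multiple_2pi)
    moreover have "cis (2 * pi * r') = cis (2 * pi * (r' - r)) * cis (2 * pi * r)"
      by (simp add: cis_mult algebra_simps)
    ultimately show ?thesis by (simp add: \<xi>_def r'_def)
  qed
  show ?thesis
  proof
    show "circle_character \<xi>"
      unfolding circle_character_def
    proof (intro conjI allI)
      show "cmod (\<xi> x) = 1" for x by (simp add: \<xi>_def)
      fix x y
      obtain r s where rs: "(x, r) \<in> \<Gamma>" "(y, s) \<in> \<Gamma>" using total by meson
      then have "(x + y, r + s) \<in> \<Gamma>" using zmod.subspace_add[OF \<Gamma>(1)] by fastforce
      then show "\<xi> (x + y) = \<xi> x * \<xi> y"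
        using rs by (simp add: \<xi> cis_mult distrib_left)
    qed
    show "\<xi> x = 1" if "x \<in> N" for x
    proof -
      have "(x, 0) \<in> \<Gamma>0" unfolding mem\<Gamma>0 using that by (intro exI[of _ 0]) simp
      then show ?thesis using \<Gamma>(2) \<xi>[of x 0] by auto
    qed
    have "(g, \<rho>) \<in> \<Gamma>0"
      unfolding mem\<Gamma>0 using zmod.subspace_0[OF N] by (intro exI[of _ 1]) simp
    then have g: "\<xi> g = cis (2 * pi * \<rho>)" using \<Gamma>(2) by (intro \<xi>) auto
    show "\<xi> g \<noteq> 1"
    proof
      assume "\<xi> g = 1"
      then have "cos (2 * pi * \<rho>) = 1" by (simp add: g complex_eq_iff)
      then obtain n :: int where "2 * pi * \<rho> = of_int n * 2 * pi" by (auto simp: cos_one_2pi_int)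
      then have "\<rho> = of_int n" by simp
      then show False using \<rho>_notin by simp
    qed
  qed
qed

section \<open>Pseudocompact groups with the finest topology of a sequence\<close>

text \<open>
  The image is a subgroup of a power of the circle, and multiplication by one of its elements is a
  homeomorphism.
\<close>

lemma homogeneous_character_image:
  assumes "\<And>k. circle_character (\<xi> k)"
  shows "homogeneous_space (top_of_set (range (\<lambda>x. \<lambda>k::nat. \<xi> k x)))"
proof -
  let ?\<Phi> = "\<lambda>x. \<lambda>k. \<xi> k x"
  let ?X = "top_of_set (range ?\<Phi>)"
  define shift where "shift c = (\<lambda>y k. \<xi> k c * y k)" for c
  have shift_\<Phi>: "shift c (?\<Phi> x) = ?\<Phi> (c + x)" for c x
    using assms by (simp add: shift_def circle_character_add)
  have cont: "continuous_map ?X ?X (shift c)" for c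
  proof -
    have "continuous_on (range ?\<Phi>) (shift c)"
      unfolding shift_def
    proof (rule continuous_on_coordinatewise_then_product)
      fix k
      have "continuous_on (range ?\<Phi>) (\<lambda>y. y k)"
        by (rule continuous_on_product_then_coordinatewise[OF continuous_on_id])
      then show "continuous_on (range ?\<Phi>) (\<lambda>y. \<xi> k c * y k)"
        by (intro continuous_on_mult continuous_on_const)
    qed
    moreover have "shift c \<in> range ?\<Phi> \<rightarrow> range ?\<Phi>"
      using shift_\<Phi> by auto
    ultimately show ?thesis by simp
  qed
  have shift_inverse: "shift (- c) (shift c y) = y" "shift c (shift (- c) y) = y" for c y
  proof -
    have "\<xi> k (- c) * \<xi> k c = 1" for k
      using circle_character_add[OF assms, of k "- c" c] circle_character_0[OF assms] by simp
    then show "shift (- c) (shift c y) = y" "shift c (shift (- c) y) = y"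
      unfolding shift_def fun_eq_iff by (simp_all add: mult.assoc[symmetric] mult.commute[of "\<xi> _ c" "\<xi> _ (- c)"])
  qed
  have homeo: "homeomorphic_map ?X ?X (shift c)" for c
    using cont[of c] cont[of "- c"] shift_inverse
    by (intro homeomorphic_maps_imp_map[of _ _ _ "shift (- c)"]) (simp add: homeomorphic_maps_def)
  have "\<exists>f. homeomorphic_map ?X ?X f \<and> f (?\<Phi> x) = ?\<Phi> y" for x y
    using homeo[of "y - x"] shift_\<Phi>[of "y - x" x] by (intro exI[of _ "shift (y - x)"]) simp
  then show ?thesis
    unfolding homogeneous_space_def topspace_euclidean_subtopology by (simp add: ball_simps)
qed

text \<open>
  A countable family of characters maps into a metrizable space, so the countable pseudocompact
  homogeneous image is automatically regular and Hausdorff.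
\<close>

lemma finite_character_image:
  assumes T: "pseudocompact T" "topspace T = UNIV"
    and \<xi>: "\<And>k::nat. circle_character (\<xi> k)" "\<And>k. continuous_map T euclidean (\<xi> k)"
    and "countable (range (\<lambda>x k. \<xi> k x))"
  shows "finite (range (\<lambda>x k. \<xi> k x))"
proof -
  let ?\<Phi> = "\<lambda>x. \<lambda>k. \<xi> k x"
  let ?X = "top_of_set (range ?\<Phi>)"
  have "continuous_map T (product_topology (\<lambda>k. euclidean) UNIV) ?\<Phi>"
    using \<xi>(2) by (simp add: continuous_map_componentwise_UNIV)
  then have "continuous_map T euclidean ?\<Phi>"
    unfolding euclidean_product_topology .
  then have "pseudocompact ?X"
    using pseudocompact_continuous_image[OF T(1)] T(2) by metis
  moreover have "metrizable_space ?X"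
    by (simp add: metrizable_space_euclidean metrizable_space_subtopology)
  ultimately have "finite (topspace ?X)"
    using assms(5) homogeneous_character_image[OF \<xi>(1)]
    by (intro finite_if_countable_pseudocompact_homogeneous
        metrizable_imp_regular_space metrizable_imp_Hausdorff_space) auto
  then show ?thesis by simp
qed

text \<open>
  Otherwise a countably infinite quotient \<open>G/N\<close> embeds into a countable power of the circle through
  characters that are trivial on all \<open>u n\<close>. These are continuous for \<open>\<tau>\<^sub>u\<close>, yet the joint image is
  countably infinite.
\<close>

lemma countable_if_pseudocompact_tau:
  fixes T :: "'a::ab_group_add topology"
  assumes T: "pseudocompact T" and tau: "is_tau u T"
  shows "countable (UNIV :: 'a set)"
proof (rule ccontr)
  assume unc: "uncountable (UNIV :: 'a set)"
  have ts: "topspace T = UNIV"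
    using conjunct1[OF tau[unfolded is_tau_def]]
    by (simp add: precompact_group_topology_def group_topology_topspace)
  define D where "D = zmod.span (range u)"
  have D: "zmod.subspace D" "countable D" by (simp_all add: D_def countable_zmod_span)
  obtain N R S where N: "zmod.subspace N" "D \<subseteq> N" and R: "countable R" "\<And>x. \<exists>r\<in>R. x - r \<in> N"
    and S: "infinite S" "\<And>x y. x \<in> S \<Longrightarrow> y \<in> S \<Longrightarrow> x - y \<in> N \<Longrightarrow> x = y"
    using ex_countably_infinite_quotient[OF D unc] by metis
  have "R \<noteq> {}" using R(2) by blast
  have "\<exists>\<eta>. circle_character \<eta> \<and> (\<forall>x\<in>N. \<eta> x = 1) \<and> (g \<notin> N \<longrightarrow> \<eta> g \<noteq> 1)" for g
  proof (cases "g \<in> N")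
    case True
    then show ?thesis by (intro exI[of _ "\<lambda>_. 1"]) (simp add: circle_character_def)
  next
    case False
    then show ?thesis by (metis ex_circle_character[OF N(1)])
  qed
  then obtain \<eta> where \<eta>: "\<And>g. circle_character (\<eta> g)" "\<And>g x. x \<in> N \<Longrightarrow> \<eta> g x = 1"
      "\<And>g. g \<notin> N \<Longrightarrow> \<eta> g g \<noteq> 1"
    by metis
  \<comment> \<open>Every element outside \<open>N\<close> is congruent to a representative in \<open>R\<close>, so one character per representative separates the cosets.\<close>
  define \<xi> where "\<xi> k = \<eta> (from_nat_into R k)" for k
  let ?\<Phi> = "\<lambda>x. \<lambda>k. \<xi> k x"
  have \<xi>: "circle_character (\<xi> k)" "x \<in> N \<Longrightarrow> \<xi> k x = 1" for k x
    using \<eta> by (simp_all add: \<xi>_def)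
  have cong: "\<eta> g x = \<eta> g y" if "x - y \<in> N" for g x y
    using circle_character_diff[OF \<eta>(1), of g x y] \<eta>(2)[OF that] circle_character_nonzero[OF \<eta>(1), of g y]
    by simp
  have "x - y \<in> N" if eq: "?\<Phi> x = ?\<Phi> y" for x y
  proof (rule ccontr)
    assume "x - y \<notin> N"
    obtain r where r: "r \<in> R" "(x - y) - r \<in> N" using R(2) by blast
    have "r \<notin> N"
      using zmod.subspace_add[OF N(1) r(2), of r] \<open>x - y \<notin> N\<close> by auto
    obtain k where k: "r = from_nat_into R k"
      using from_nat_into_surj[OF R(1) r(1)] by metis
    have "\<eta> r x = \<eta> r y" using fun_cong[OF eq, of k] by (simp add: \<xi>_def k)
    then have "\<eta> r (x - y) = 1"
      using circle_character_diff[OF \<eta>(1)] circle_character_nonzero[OF \<eta>(1)] by simp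
    then have "\<eta> r r = 1" using cong[OF r(2)] by simp
    then show False using \<eta>(3) \<open>r \<notin> N\<close> by simp
  qed
  then have "inj_on ?\<Phi> S" using S(2) by (meson inj_onI)
  then have "infinite (range ?\<Phi>)"
    using S(1) by (meson finite_imageD finite_subset image_mono subset_UNIV)
  moreover have "countable (range ?\<Phi>)"
  proof (rule countable_subset)
    show "range ?\<Phi> \<subseteq> ?\<Phi> ` R"
    proof
      fix y assume "y \<in> range ?\<Phi>"
      then obtain x where x: "y = ?\<Phi> x" by blast
      obtain r where "r \<in> R" "x - r \<in> N" using R(2) by blast
      then show "y \<in> ?\<Phi> ` R"
        using cong[of x r] by (intro image_eqI[of _ _ r]) (simp_all add: x \<xi>_def)
    qed
  qed (use R(1) in simp)
  moreover have "continuous_map T euclidean (\<xi> k)" for k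
  proof (rule is_tau_character_continuous[OF tau \<xi>(1)])
    have "u n \<in> N" for n
      using N(2) zmod.span_base[of "u n" "range u"] by (auto simp: D_def)
    then show "(\<lambda>n. \<xi> k (u n)) \<longlonglongrightarrow> 1" by (simp add: \<xi>(2))
  qed
  ultimately show False
    using finite_character_image[OF T ts, of \<xi>] \<xi>(1) by simp
qed

lemma is_tau_zero_if_finite:
  fixes T :: "'a::ab_group_add topology"
  assumes "group_topology T" "Hausdorff_space T" and fin: "finite (UNIV :: 'a set)"
  shows "is_tau (\<lambda>_. 0) T"
proof -
  have ts: "topspace T = UNIV" using assms(1) by (rule group_topology_topspace)
  \<comment> \<open>A finite Hausdorff space is discrete, so no topology is finer.\<close>
  have "closedin T U" for U
    using assms(2) fin ts by (metis Hausdorff_imp_t1_space finite_subset subset_UNIV t1_space_closedin_finite)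
  then have opn: "openin T U" for U
    using ts openin_closedin_eq[of T U] by simp
  have "UNIV + U = (UNIV :: 'a set)" if "0 \<in> U" for U
    using set_plus_intro[OF UNIV_I that] by force
  then have "precompact_group_topology T"
    using assms by (auto simp: precompact_group_topology_def)
  moreover have "limitin T (\<lambda>_. 0) 0 sequentially"
    by (simp add: limitin_def ts)
  ultimately show ?thesis
    unfolding is_tau_def using opn by blast
qed

theorem corollaryC1:
  fixes T :: "'a::ab_group_add topology"
  assumes "group_topology T" and "Hausdorff_space T" and "pseudocompact T"
  shows "ss_characterized T \<longleftrightarrow> finite (UNIV :: 'a set)"
proof
  assume "ss_characterized T"
  then obtain u where "is_tau u T" unfolding ss_characterized_def by blast
  then have "countable (topspace T)"
    using countable_if_pseudocompact_tau assms(1,3) by (metis group_topology_topspace)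
  then have "finite (topspace T)"
    using assms by (intro finite_if_countable_pseudocompact_homogeneous
        group_topology_regular group_topology_homogeneous)
  then show "finite (UNIV :: 'a set)"
    using assms(1) by (simp add: group_topology_topspace)
next
  assume "finite (UNIV :: 'a set)"
  then have tau: "is_tau (\<lambda>_. 0) T" using assms by (intro is_tau_zero_if_finite)
  note tau' = tau[unfolded is_tau_def]
  have "TB_sequence (\<lambda>_. 0 :: 'a)"
    unfolding TB_sequence_def using conjunct1[OF tau'] conjunct1[OF conjunct2[OF tau']] by blast
  then show "ss_characterized T"
    unfolding ss_characterized_def using conjunct1[OF tau'] tau by blast
qed

end
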